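(* Let $A\in\mathbb{R}^{m\times n}$ be a full-rank matrix whose rows $a_1^T,\dots,a_m^T$ have unit Euclidean norm, let $\hat x\in\mathbb{R}^n$, $\hat x\neq 0$, put $\tilde b=A\hat x$, and let $b=\tilde b+b^c+r$, where $b^c\in\mathbb{R}^m$ has exactly $\beta m$ nonzero entries ($\|b^c\|_0=\beta m$) and $r\in\mathbb{R}^m$ is arbitrary. Let $\lambda>0$ and $\beta<q<1-\beta$, and set $\alpha=\frac{|\hat x|_{\min}}{|\hat x|_{\min}+2\lambda}$. Assume that $$\frac{2\sqrt{\beta(1-\beta)}}{1-\beta-q}\left(\sigma_{\max}+\sqrt{\frac{(1-\beta)m}{n}}\right)+\frac{\beta(1-\beta)}{(1-\beta-q)^2}\left(\sigma_{\max}+2\sqrt{\frac{(1-\beta)m}{n}}\right)<\frac{\alpha(q-\beta)}{2q}\,\frac{\tilde\sigma_{q-\beta,\min}^2}{\sigma_{\max}} .$$ Define $$C_1=\frac{\alpha(q-\beta)}{2q^2}\frac{\tilde\sigma_{q-\beta,\min}^2}{m}-\frac{2\sqrt{\beta(1-\beta)}}{q(1-\beta-q)}\left(\frac{\sigma_{\max}^2}{m}+\frac{\sqrt{1-\beta}\,\sigma_{\max}}{\sqrt{mn}}\right)-\frac{\beta(1-\beta)}{q(1-\beta-q)^2}\left(\frac{\sigma_{\max}^2}{m}+\frac{2\sqrt{1-\beta}\,\sigma_{\max}}{\sqrt{mn}}\right),$$ $$C_2=\frac{\sqrt{\beta}(1-\beta)}{q(1-\beta-q)}\left(1+\frac{\sqrt{\beta(1-\beta)}}{1-\beta-q}\right)\sqrt{\frac{n}{m}}\,\sigma_{\max}+\frac12\,\frac{\beta(1-\beta)^2}{q(1-\beta-q)^2}+\frac12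 .$$ Then for every $k\ge 0$: (a) the iterates generated by Quantile-RaSK with inexact step, run on $(A,b)$, satisfy $$\mathbb{E}\big[D_f^{x_{k+1}^*}(x_{k+1},\hat x)\big]\le(1-C_1)\,\mathbb{E}\big[D_f^{x_k^*}(x_k,\hat x)\big]+C_2\|r\|_\infty^2 ;$$ (b) the iterates generated by Quantile-RaSK with exact step, run on $(A,b)$, satisfy $$\mathbb{E}\big[D_f^{x_{k+1}^*}(x_{k+1},\hat x)\big]\le(1-C_1)\,\mathbb{E}\big[D_f^{x_k^*}(x_k,\hat x)\big]+C_2\|r\|_\infty^2+\frac{2}{\sqrt{qm}}\|r\|_\infty\|A\|_{1,2}+\frac{2\lambda}{qm}\|b-\tilde b\|\,\|A\|_{1,2}.$$
   Context: Notation. $\|\cdot\|$ is the Euclidean norm; $\|A\|_{1,2}=\sqrt{\sum_{i=1}^m\|a_i\|_1^2}$; $|\hat x|_{\min}=\min\{|\hat x_j|:\hat x_j\ne0\}$. It is assumed that $\beta m$ and $qm$ are integers. For a matrix $M$, $\sigma_{\min}(M)=\min_{x\ne0}\|Mx\|/\|x\|$ and $\sigma_{\max}(M)=\max_{x\neq 0}\|Mx\|/\|x\|$; $\sigma_{\max}=\sigma_{\max}(A)$. With $A_{I,J}$ the submatrix of $A$ with rows indexed by $I$ and columns indexed by $J$, $$\tilde\sigma_{q-\beta,\min}=\min\{\sigma_{\min}(A_{I,J}): I\subset\{1,\dots,m\},\ |I|=(q-\beta)m,\ \emptyset\ne J\subset\{1,\dots,n\}\}.$$ Function and Bregman distance.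 $f(x)=\lambda\|x\|_1+\frac12\|x\|^2$, with Fenchel conjugate $f^*(x)=\sup_z\{\langle x,z\rangle-f(z)\}$. For $x^*\in\partial f(x)$, $D_f^{x^*}(x,y)=f(y)-f(x)-\langle x^*,y-x\rangle$. The soft shrinkage $\mathcal S_\lambda(x)=\max\{|x|-\lambda,0\}\cdot\mathrm{sign}(x)$ is applied componentwise. Quantile. For reals $y_1,\dots,y_m$ sorted increasingly as $y_{(1)}\le\dots\le y_{(m)}$ and $qm$ an integer, the $q$-quantile is $(y_{(qm)}+y_{(qm+1)})/2$. Quantile-RaSK. Start from $x_0=x_0^*=0$. At step $k$, let $Q_k$ be the $q$-quantile of the residuals $|\langle a_i,x_k\rangle-b_i|$, $1\le i\le m$; let $N_2=\{i:|\langle a_i,x_k\rangle-b_i|\le Q_k\}$ (understood to have exactly $qm$ elements); sample $i_k\in N_2$ at random, each element with probability $1/(qm)$ (conditionally on the past); choose $t_k$ by - inexact step: $t_k=\langle a_{i_k},x_k\rangle-b_{i_k}$; - exact step: $t_k\in\arg\min_{t\in\mathbb{R}}\, f^*(x_k^*-t a_{i_k})+t\,b_{i_k}$; and set $x_{k+1}^*=x_k^*-t_k a_{i_k}$, $x_{k+1}=\mathcal S_\lambda(x_{k+1}^* )$ (so $x_k^*\in\partial f(x_k)$). Expectations are over the random indices $i_0,i_1,\dots$. *)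

theory Defs
  imports "HOL-Probability.Probability"
begin

section \<open>Norms and singular values\<close>

definition norm1 :: "real ^ 'n \<Rightarrow> real" where
  "norm1 x = (\<Sum>j\<in>UNIV. \<bar>x $ j\<bar>)"

definition norm12 :: "real ^ 'n ^ 'm \<Rightarrow> real" where
  "norm12 A = sqrt (\<Sum>i\<in>UNIV. (norm1 (A $ i))\<^sup>2)"

definition abs_min :: "real ^ 'n \<Rightarrow> real" where
  "abs_min x = Min {\<bar>x $ j\<bar> | j. x $ j \<noteq> 0}"

definition sigma_max :: "real ^ 'n ^ 'm \<Rightarrow> real" where
  "sigma_max A = Sup {norm (A *v x) / norm x | x. x \<noteq> 0}"

text \<open>The smallest singular value of the submatrix of \<open>A\<close> with rows \<open>I\<close> and columns \<open>J\<close>.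
  A vector indexed by \<open>J\<close> is represented by any \<open>x\<close> in the full space, of which only the
  components in \<open>J\<close> are used, so "nonzero" means nonzero on \<open>J\<close>.\<close>

definition sigma_min_sub :: "real ^ 'n ^ 'm \<Rightarrow> 'm set \<Rightarrow> 'n set \<Rightarrow> real" where
  "sigma_min_sub A I J =
     Inf {L2_set (\<lambda>i. \<Sum>j\<in>J. A $ i $ j * x $ j) I / L2_set (\<lambda>j. x $ j) J
          | x :: real ^ 'n. \<exists>j\<in>J. x $ j \<noteq> 0}"

text \<open>The parameter \<open>s\<close> is the row count as a real number, since it is used with
  \<open>s = (q - \<beta>) * m\<close>.\<close>

definition sigma_tilde_min :: "real ^ 'n ^ 'm \<Rightarrow> real \<Rightarrow> real" where
  "sigma_tilde_min A s = Min {sigma_min_sub A I J | I J. real (card I) = s \<and> J \<noteq> {}}"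


section \<open>The objective, its conjugate and the Bregman distance\<close>

definition objective :: "real \<Rightarrow> real ^ 'n \<Rightarrow> real" where
  "objective lam x = lam * norm1 x + (norm x)\<^sup>2 / 2"

text \<open>The supremum is taken in the reals, which is adequate because it is only applied to
  \<open>objective lam\<close> with \<open>lam > 0\<close>, whose conjugate is finite everywhere.\<close>

definition fenchel_conj :: "(real ^ 'n \<Rightarrow> real) \<Rightarrow> real ^ 'n \<Rightarrow> real" where
  "fenchel_conj f x = (SUP z. x \<bullet> z - f z)"

definition bregman :: "(real ^ 'n \<Rightarrow> real) \<Rightarrow> real ^ 'n \<Rightarrow> real ^ 'n \<Rightarrow> real ^ 'n \<Rightarrow> real" where
  "bregman f xs x y = f y - f x - xs \<bullet> (y - x)"

definition shrink :: "real \<Rightarrow> real ^ 'n \<Rightarrow> real ^ 'n" where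
  "shrink lam x = (\<chi> j. max (\<bar>x $ j\<bar> - lam) 0 * sgn (x $ j))"

text \<open>Every dual iterate is a subgradient at the corresponding primal iterate, so that the
  Bregman distance is only ever used with an admissible first argument.\<close>

lemma shrink_subgradient:
  fixes xs :: "real ^ 'n"
  assumes "lam \<ge> 0"
  shows "objective lam y \<ge> objective lam (shrink lam xs) + xs \<bullet> (y - shrink lam xs)"
proof -
  define x where "x = shrink lam xs"
  have sq: "(norm v)\<^sup>2 = (\<Sum>j\<in>UNIV. (v $ j)\<^sup>2)" for v :: "real ^ 'n"
    by (simp add: norm_vec_def L2_set_def sum_nonneg)
  have obj: "objective lam v = (\<Sum>j\<in>UNIV. lam * \<bar>v $ j\<bar> + (v $ j)\<^sup>2 / 2)" for v :: "real ^ 'n"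
    by (simp add: objective_def norm1_def sq sum.distrib sum_distrib_left sum_divide_distrib)
  have scalar: "lam * \<bar>u\<bar> + u\<^sup>2 / 2 + v * (w - u) \<le> lam * \<bar>w\<bar> + w\<^sup>2 / 2"
    if u: "u = max (\<bar>v\<bar> - lam) 0 * sgn v" for u v w :: real
  proof -
    define s where "s = v - u"
    have s: "\<bar>s\<bar> \<le> lam" and su: "s * u = lam * \<bar>u\<bar>"
      using u assms by (auto simp: s_def max_def sgn_if abs_if split: if_splits)
    have "s * w \<le> \<bar>s\<bar> * \<bar>w\<bar>" by (metis abs_ge_self abs_mult)
    also have "\<dots> \<le> lam * \<bar>w\<bar>" using s by (simp add: mult_right_mono)
    finally have sw: "s * w \<le> lam * \<bar>w\<bar>" .
    have "w\<^sup>2 / 2 - u\<^sup>2 / 2 - u * (w - u) = (w - u)\<^sup>2 / 2"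
      by (simp add: power2_eq_square field_simps)
    then have "u * (w - u) \<le> w\<^sup>2 / 2 - u\<^sup>2 / 2"
      using zero_le_power2[of "w - u"] by linarith
    moreover have "v * (w - u) = s * w - s * u + u * (w - u)"
      by (simp add: s_def algebra_simps)
    ultimately show ?thesis using sw su by linarith
  qed
  have "objective lam x + xs \<bullet> (y - x) =
      (\<Sum>j\<in>UNIV. lam * \<bar>x $ j\<bar> + (x $ j)\<^sup>2 / 2 + xs $ j * (y $ j - x $ j))"
    by (simp add: obj inner_vec_def sum.distrib)
  also have "\<dots> \<le> objective lam y"
    unfolding obj by (intro sum_mono scalar) (simp add: x_def shrink_def)
  finally show ?thesis by (simp add: x_def)
qed


section \<open>Quantile-RaSK\<close>

text \<open>The sorted list is indexed from zero, so the order statistics number \<open>q m\<close> and \<open>q m + 1\<close>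
  are the entries \<open>l - 1\<close> and \<open>l\<close>. Meaningful when \<open>q m\<close> is an integer and \<open>0 < q < 1\<close>.\<close>

definition quantile :: "real \<Rightarrow> ('m::finite \<Rightarrow> real) \<Rightarrow> real" where
  "quantile q y =
     (let ys = sorted_list_of_multiset (image_mset y (mset_set UNIV));
          l = nat \<lfloor>q * real CARD('m)\<rfloor>
      in (ys ! (l - 1) + ys ! l) / 2)"

definition residual :: "real ^ 'n ^ 'm \<Rightarrow> real ^ 'm \<Rightarrow> real ^ 'n \<Rightarrow> 'm \<Rightarrow> real" where
  "residual A b x i = \<bar>A $ i \<bullet> x - b $ i\<bar>"

text \<open>Step rules: \<open>xs\<close> is the current dual iterate, \<open>i\<close> the sampled row, \<open>t\<close> the step.\<close>

definition inexact_step ::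
    "real \<Rightarrow> real ^ 'n ^ 'm \<Rightarrow> real ^ 'm \<Rightarrow> real ^ 'n \<Rightarrow> 'm \<Rightarrow> real \<Rightarrow> bool" where
  "inexact_step lam A b xs i t \<longleftrightarrow> t = A $ i \<bullet> shrink lam xs - b $ i"

definition exact_step ::
    "real \<Rightarrow> real ^ 'n ^ 'm \<Rightarrow> real ^ 'm \<Rightarrow> real ^ 'n \<Rightarrow> 'm \<Rightarrow> real \<Rightarrow> bool" where
  "exact_step lam A b xs i t \<longleftrightarrow>
     is_arg_min (\<lambda>t. fenchel_conj (objective lam) (xs - t *\<^sub>R A $ i) + t * b $ i) (\<lambda>_. True) t"

text \<open>A run is described as a function of the history \<open>h = [i_0, ..., i_(k-1)]\<close> of sampled
  indices: \<open>xs h\<close> is the dual iterate reached after \<open>h\<close> (the primal one is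
  \<open>shrink lam (xs h)\<close>), \<open>N h\<close> the set from which the next index is drawn, and \<open>t h i\<close> the step
  taken if that index is \<open>i\<close>.

  The set \<open>N h\<close> has exactly \<open>q m\<close> elements with residual at most the quantile. If there are
  exactly \<open>q m\<close> such rows, this forces \<open>N h\<close> to be the set of all of them. There can only be more
  if the residuals of ranks \<open>q m\<close> and \<open>q m + 1\<close> are tied, and then any choice is allowed. Likewise
  any choice of minimiser is allowed for the exact step; both may depend on the whole history.\<close>

definition quantile_rask ::
    "(real \<Rightarrow> real ^ 'n ^ 'm \<Rightarrow> real ^ 'm \<Rightarrow> real ^ 'n \<Rightarrow> 'm \<Rightarrow> real \<Rightarrow> bool) \<Rightarrow>
     real \<Rightarrow> real \<Rightarrow> real ^ 'n ^ 'm \<Rightarrow> real ^ 'm \<Rightarrow>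
     ('m list \<Rightarrow> 'm set) \<Rightarrow> ('m list \<Rightarrow> 'm \<Rightarrow> real) \<Rightarrow> ('m list \<Rightarrow> real ^ 'n) \<Rightarrow> bool" where
  "quantile_rask step_rule lam q A b N t xs \<longleftrightarrow>
     xs [] = 0 \<and>
     (\<forall>h. let res = residual A b (shrink lam (xs h)) in
        N h \<subseteq> {i. res i \<le> quantile q res} \<and>
        real (card (N h)) = q * real CARD('m) \<and>
        (\<forall>i\<in>N h. step_rule lam A b (xs h) i (t h i) \<and>
                 xs (h @ [i]) = xs h - t h i *\<^sub>R A $ i))"

text \<open>Joint law of the first \<open>k\<close> sampled indices: given the history \<open>h\<close>, the next index is
  uniformly distributed on \<open>N h\<close>.\<close>

primrec index_law :: "('m list \<Rightarrow> 'm set) \<Rightarrow> nat \<Rightarrow> 'm list pmf" where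
  "index_law N 0 = return_pmf []"
| "index_law N (Suc k) =
     bind_pmf (index_law N k) (\<lambda>h. map_pmf (\<lambda>i. h @ [i]) (pmf_of_set (N h)))"

definition expected_bregman ::
    "real \<Rightarrow> real ^ 'n \<Rightarrow> ('m list \<Rightarrow> 'm set) \<Rightarrow> ('m list \<Rightarrow> real ^ 'n) \<Rightarrow> nat \<Rightarrow> real" where
  "expected_bregman lam xhat N xs k =
     measure_pmf.expectation (index_law N k)
       (\<lambda>h. bregman (objective lam) (xs h) (shrink lam (xs h)) xhat)"

end

theory Submission
  imports Defs
begin

text \<open>Write \<open>e\<^sub>i = \<langle>a\<^sub>i, x - xhat\<rangle>\<close> and \<open>c\<^sub>i = b\<^sub>i - btilde\<^sub>i\<close>. Since the conjugate of the objective is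
  1-smooth, an inexact step changes the Bregman distance \<open>D\<close> by at most
  \<open>- (e\<^sub>i - c\<^sub>i) e\<^sub>i + (e\<^sub>i - c\<^sub>i)\<^sup>2 / 2\<close>. The sum over the accepted uncorrupted rows is controlled by
  \<open>sigma_tilde_min\<close>. On a corrupted accepted row the change is at most \<open>Q \<bar>e\<^sub>i\<bar> + Q\<^sup>2 / 2\<close>, and the
  quantile \<open>Q\<close> is at most the mean residual of the \<open>(1 - q - \<beta>) m\<close> or more uncorrupted rows whose
  residual is at least \<open>Q\<close>. Everything is converted to \<open>D\<close> by
  \<open>\<alpha> D \<le> \<parallel>x - xhat\<parallel>\<^sup>2 \<le> 2 D\<close>. The exact step minimises the conjugate term, and it differs from the
  inexact step by at most \<open>2 lam \<parallel>a\<^sub>i\<parallel>\<^sub>1\<close>, so it costs only the additional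
  \<open>2 lam \<parallel>a\<^sub>i\<parallel>\<^sub>1 \<bar>c\<^sub>i\<bar>\<close> per row.\<close>

lemma norm_sq_sum: "(norm v)\<^sup>2 = (\<Sum>j\<in>UNIV. (v $ j)\<^sup>2)" for v :: "real ^ 'n"
  by (simp add: norm_vec_def L2_set_def sum_nonneg)

lemma shrink_component:
  fixes xs :: "real ^ 'n"
  assumes "lam \<ge> 0"
  shows "\<bar>xs $ j - shrink lam xs $ j\<bar> \<le> lam"
    and "(xs $ j - shrink lam xs $ j) * shrink lam xs $ j = lam * \<bar>shrink lam xs $ j\<bar>"
  using assms by (auto simp: shrink_def max_def sgn_if abs_if split: if_splits)

lemma bregman_shrink_eq:
  fixes xs y :: "real ^ 'n"
  assumes "lam \<ge> 0"
  shows "bregman (objective lam) xs (shrink lam xs) y =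
    (norm (shrink lam xs - y))\<^sup>2 / 2
    + (\<Sum>j\<in>UNIV. lam * \<bar>y $ j\<bar> - (xs $ j - shrink lam xs $ j) * y $ j)"
proof -
  define x where "x = shrink lam xs"
  have obj: "objective lam v = (\<Sum>j\<in>UNIV. lam * \<bar>v $ j\<bar> + (v $ j)\<^sup>2 / 2)" for v :: "real ^ 'n"
    by (simp add: objective_def norm1_def norm_sq_sum sum.distrib sum_distrib_left sum_divide_distrib)
  have "bregman (objective lam) xs x y =
    (\<Sum>j\<in>UNIV. (lam * \<bar>y $ j\<bar> + (y $ j)\<^sup>2 / 2) - (lam * \<bar>x $ j\<bar> + (x $ j)\<^sup>2 / 2)
       - xs $ j * (y $ j - x $ j))"
    by (simp add: bregman_def obj inner_vec_def sum_subtractf)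
  also have "\<dots> = (\<Sum>j\<in>UNIV. (x $ j - y $ j)\<^sup>2 / 2
      + (lam * \<bar>y $ j\<bar> - (xs $ j - x $ j) * y $ j))"
  proof (rule sum.cong[OF refl])
    fix j
    have "lam * \<bar>x $ j\<bar> = (xs $ j - x $ j) * x $ j"
      using shrink_component(2)[OF assms, of xs j] by (simp add: x_def)
    then show "(lam * \<bar>y $ j\<bar> + (y $ j)\<^sup>2 / 2) - (lam * \<bar>x $ j\<bar> + (x $ j)\<^sup>2 / 2)
       - xs $ j * (y $ j - x $ j)
       = (x $ j - y $ j)\<^sup>2 / 2 + (lam * \<bar>y $ j\<bar> - (xs $ j - x $ j) * y $ j)"
      by (simp add: power2_eq_square field_simps)
  qed
  finally show ?thesis
    by (simp add: x_def norm_sq_sum sum.distrib sum_divide_distrib)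
qed

lemma norm_sq_le_bregman:
  fixes xs y :: "real ^ 'n"
  assumes "lam \<ge> 0"
  shows "(norm (shrink lam xs - y))\<^sup>2 / 2 \<le> bregman (objective lam) xs (shrink lam xs) y"
proof -
  have "(xs $ j - shrink lam xs $ j) * y $ j \<le> lam * \<bar>y $ j\<bar>" for j
  proof -
    have "(xs $ j - shrink lam xs $ j) * y $ j \<le> \<bar>xs $ j - shrink lam xs $ j\<bar> * \<bar>y $ j\<bar>"
      by (metis abs_ge_self abs_mult)
    also have "\<dots> \<le> lam * \<bar>y $ j\<bar>"
      by (intro mult_right_mono shrink_component assms) auto
    finally show ?thesis .
  qed
  then show ?thesis
    unfolding bregman_shrink_eq[OF assms] by (simp add: sum_nonneg)
qed

lemma abs_min_props:
  fixes y :: "real ^ 'n"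
  assumes "y \<noteq> 0"
  shows "abs_min y > 0" and "y $ j \<noteq> 0 \<Longrightarrow> abs_min y \<le> \<bar>y $ j\<bar>"
proof -
  have fin: "finite {\<bar>y $ j\<bar> | j. y $ j \<noteq> 0}" by simp
  obtain i where "y $ i \<noteq> 0" using assms by (metis vec_eq_iff zero_index)
  then have "{\<bar>y $ j\<bar> | j. y $ j \<noteq> 0} \<noteq> {}" by auto
  then show "abs_min y > 0" using fin unfolding abs_min_def by (subst Min_gr_iff) auto
  show "y $ j \<noteq> 0 \<Longrightarrow> abs_min y \<le> \<bar>y $ j\<bar>"
    using fin unfolding abs_min_def by (intro Min_le) auto
qed

lemma bregman_le_norm_sq:
  fixes xs y :: "real ^ 'n"
  assumes lam: "lam \<ge> 0" and y: "y \<noteq> 0"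
  shows "abs_min y / (abs_min y + 2 * lam) * bregman (objective lam) xs (shrink lam xs) y
    \<le> (norm (shrink lam xs - y))\<^sup>2"
proof -
  define x where "x = shrink lam xs"
  define \<mu> where "\<mu> = abs_min y"
  have \<mu>: "\<mu> > 0" using abs_min_props(1)[OF y] by (simp add: \<mu>_def)
  have "lam * \<bar>y $ j\<bar> - (xs $ j - x $ j) * y $ j \<le> 2 * lam / \<mu> * (x $ j - y $ j)\<^sup>2" for j
  proof (cases "y $ j = 0 \<or> x $ j * y $ j > 0")
    case True
    have "lam * \<bar>y $ j\<bar> = (xs $ j - x $ j) * y $ j"
    proof (cases "y $ j = 0")
      case False
      with True have "x $ j * y $ j > 0" by simp
      then show ?thesis using lam
        by (auto simp: x_def shrink_def max_def sgn_if abs_if zero_less_mult_iff mult_less_0_iff split: if_splits)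
    qed simp
    then show ?thesis using lam \<mu> by simp
  next
    case False
    then have yj: "y $ j \<noteq> 0" and xy: "x $ j * y $ j \<le> 0" by auto
    have "\<bar>xs $ j - x $ j\<bar> * \<bar>y $ j\<bar> \<le> lam * \<bar>y $ j\<bar>"
      unfolding x_def by (intro mult_right_mono shrink_component lam) auto
    then have "lam * \<bar>y $ j\<bar> - (xs $ j - x $ j) * y $ j \<le> 2 * lam * \<bar>y $ j\<bar>"
      using abs_ge_minus_self[of "(xs $ j - x $ j) * y $ j"] unfolding abs_mult by linarith
    also have "\<dots> \<le> 2 * lam * ((x $ j - y $ j)\<^sup>2 / \<mu>)"
    proof (intro mult_left_mono)
      have "\<bar>y $ j\<bar> * \<mu> \<le> \<bar>y $ j\<bar> * \<bar>y $ j\<bar>"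
        using abs_min_props(2)[OF y yj] by (intro mult_left_mono) (auto simp: \<mu>_def)
      also have "\<dots> = (y $ j)\<^sup>2" by (simp add: power2_eq_square)
      also have "\<dots> \<le> (x $ j - y $ j)\<^sup>2"
        using xy zero_le_power2[of "x $ j"] unfolding power2_diff mult.assoc by linarith
      finally show "\<bar>y $ j\<bar> \<le> (x $ j - y $ j)\<^sup>2 / \<mu>" using \<mu> by (simp add: field_simps)
    qed (use lam in auto)
    finally show ?thesis by simp
  qed
  then have "(\<Sum>j\<in>UNIV. lam * \<bar>y $ j\<bar> - (xs $ j - x $ j) * y $ j)
    \<le> (\<Sum>j\<in>UNIV. 2 * lam / \<mu> * (x $ j - y $ j)\<^sup>2)" by (intro sum_mono)
  also have "\<dots> = 2 * lam / \<mu> * (norm (x - y))\<^sup>2"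
    by (simp add: norm_sq_sum sum_distrib_left)
  finally have "bregman (objective lam) xs x y \<le> (1 / 2 + 2 * lam / \<mu>) * (norm (x - y))\<^sup>2"
    using bregman_shrink_eq[OF lam, of xs y] by (simp add: x_def algebra_simps)
  also have "\<dots> \<le> (1 + 2 * lam / \<mu>) * (norm (x - y))\<^sup>2"
    by (intro mult_right_mono) auto
  also have "1 + 2 * lam / \<mu> = (\<mu> + 2 * lam) / \<mu>" using \<mu> by (simp add: field_simps)
  finally show ?thesis using \<mu> lam by (simp add: field_simps x_def \<mu>_def add_nonneg_pos)
qed

lemma fenchel_conj_objective:
  fixes xs :: "real ^ 'n"
  assumes "lam \<ge> 0"
  shows "fenchel_conj (objective lam) xs = xs \<bullet> shrink lam xs - objective lam (shrink lam xs)"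
proof -
  have "xs \<bullet> z - objective lam z \<le> xs \<bullet> shrink lam xs - objective lam (shrink lam xs)" for z
    using shrink_subgradient[OF assms, of xs z] by (simp add: inner_diff_right)
  then show ?thesis unfolding fenchel_conj_def
    by (intro cSup_eq_maximum) auto
qed

lemma bregman_conj:
  fixes xs y :: "real ^ 'n"
  assumes "lam \<ge> 0"
  shows "bregman (objective lam) xs (shrink lam xs) y =
    fenchel_conj (objective lam) xs - xs \<bullet> y + objective lam y"
  using assms by (simp add: bregman_def fenchel_conj_objective inner_diff_right)

lemma fenchel_conj_smooth:
  fixes xs v :: "real ^ 'n"
  assumes lam: "lam \<ge> 0"
  shows "fenchel_conj (objective lam) (xs + v)
    \<le> fenchel_conj (objective lam) xs + v \<bullet> shrink lam xs + (norm v)\<^sup>2 / 2"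
proof -
  define x z where "x = shrink lam xs" and "z = shrink lam (xs + v)"
  have "(norm (x - z))\<^sup>2 / 2 \<le> fenchel_conj (objective lam) xs - xs \<bullet> z + objective lam z"
    using norm_sq_le_bregman[OF lam, of xs z] bregman_conj[OF lam, of xs z] by (simp add: x_def)
  moreover have "fenchel_conj (objective lam) (xs + v) = xs \<bullet> z + v \<bullet> z - objective lam z"
    by (simp add: fenchel_conj_objective[OF lam] z_def inner_add_left)
  moreover have "v \<bullet> z - v \<bullet> x \<le> (norm v)\<^sup>2 / 2 + (norm (x - z))\<^sup>2 / 2"
    using zero_le_power2[of "norm (v + (x - z))"]
    by (simp only: power2_norm_eq_inner)
      (simp add: inner_add_left inner_add_right inner_diff_left inner_diff_right inner_commute field_simps)
  ultimately show ?thesis by (simp add: x_def)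
qed

lemma bregman_step:
  fixes xs a y :: "real ^ 'n"
  assumes lam: "lam \<ge> 0" and a: "norm a = 1"
  shows "bregman (objective lam) (xs - t *\<^sub>R a) (shrink lam (xs - t *\<^sub>R a)) y
    \<le> bregman (objective lam) xs (shrink lam xs) y - t * (a \<bullet> (shrink lam xs - y)) + t\<^sup>2 / 2"
  using fenchel_conj_smooth[OF lam, of xs "- (t *\<^sub>R a)"] a
  by (simp add: bregman_conj[OF lam] inner_diff_left inner_diff_right algebra_simps)

text \<open>Optimality of the exact step gives \<open>a \<bullet> x\<^sub>+ = b\<close> for the new primal iterate, and
  primal and dual iterates differ componentwise by at most \<open>lam\<close>.\<close>

lemma exact_step_close:
  fixes A :: "real ^ 'n ^ 'm"
  assumes lam: "lam \<ge> 0" and a: "norm (A $ i) = 1"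
    and t: "exact_step lam A b xs i t"
  shows "\<bar>(A $ i \<bullet> shrink lam xs - b $ i) - t\<bar> \<le> 2 * lam * norm1 (A $ i)"
proof -
  define a where "a = A $ i"
  define ys where "ys = xs - t *\<^sub>R a"
  define \<kappa> where "\<kappa> = a \<bullet> shrink lam ys - b $ i"
  have aa: "a \<bullet> a = 1" using a by (simp add: a_def norm_eq_1)
  have "fenchel_conj (objective lam) (xs - t *\<^sub>R a) + t * b $ i
      \<le> fenchel_conj (objective lam) (xs - (t + \<kappa>) *\<^sub>R a) + (t + \<kappa>) * b $ i"
    using t unfolding exact_step_def is_arg_min_def a_def by (meson not_less)
  also have "xs - (t + \<kappa>) *\<^sub>R a = ys + (- (\<kappa> *\<^sub>R a))"
    by (simp add: ys_def algebra_simps)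
  also have "fenchel_conj (objective lam) \<dots>
      \<le> fenchel_conj (objective lam) ys - \<kappa> * (a \<bullet> shrink lam ys) + \<kappa>\<^sup>2 / 2"
    using fenchel_conj_smooth[OF lam, of ys "- (\<kappa> *\<^sub>R a)"] a by (simp add: a_def)
  finally have "\<kappa> * \<kappa> \<le> \<kappa>\<^sup>2 / 2" by (simp add: \<kappa>_def ys_def algebra_simps)
  then have "\<kappa> = 0" by (auto simp: power2_eq_square mult_le_0_iff)
  then have bi: "b $ i = a \<bullet> shrink lam ys" by (simp add: \<kappa>_def)
  have "(a \<bullet> shrink lam xs - b $ i) - t = a \<bullet> ((ys - shrink lam ys) - (xs - shrink lam xs))"
    by (simp add: bi ys_def inner_diff_right aa)
  also have "\<bar>\<dots>\<bar> \<le> (\<Sum>j\<in>UNIV. \<bar>a $ j * ((ys $ j - shrink lam ys $ j) - (xs $ j - shrink lam xs $ j))\<bar>)"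
    unfolding inner_vec_def by (simp add: sum_abs)
  also have "\<dots> \<le> (\<Sum>j\<in>UNIV. \<bar>a $ j\<bar> * (2 * lam))"
  proof (rule sum_mono)
    fix j
    have "\<bar>(ys $ j - shrink lam ys $ j) - (xs $ j - shrink lam xs $ j)\<bar> \<le> 2 * lam"
      using shrink_component(1)[OF lam, of ys j] shrink_component(1)[OF lam, of xs j] by linarith
    then show "\<bar>a $ j * ((ys $ j - shrink lam ys $ j) - (xs $ j - shrink lam xs $ j))\<bar> \<le> \<bar>a $ j\<bar> * (2 * lam)"
      by (simp add: abs_mult mult_left_mono)
  qed
  finally show ?thesis by (simp add: a_def norm1_def sum_distrib_left mult.commute)
qed

lemma bregman_exact_step:
  fixes A :: "real ^ 'n ^ 'm"
  assumes lam: "lam \<ge> 0" and a: "norm (A $ i) = 1"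
    and t: "exact_step lam A b xs i t"
  defines "s \<equiv> A $ i \<bullet> shrink lam xs - b $ i"
  shows "bregman (objective lam) (xs - t *\<^sub>R A $ i) (shrink lam (xs - t *\<^sub>R A $ i)) y
    \<le> bregman (objective lam) xs (shrink lam xs) y
      - s * (A $ i \<bullet> (shrink lam xs - y)) + s\<^sup>2 / 2
      + 2 * lam * norm1 (A $ i) * \<bar>b $ i - A $ i \<bullet> y\<bar>"
proof -
  have "fenchel_conj (objective lam) (xs - t *\<^sub>R A $ i) + t * b $ i
      \<le> fenchel_conj (objective lam) (xs - s *\<^sub>R A $ i) + s * b $ i"
    using t unfolding exact_step_def is_arg_min_def by (meson not_less)
  then have "bregman (objective lam) (xs - t *\<^sub>R A $ i) (shrink lam (xs - t *\<^sub>R A $ i)) y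
    \<le> bregman (objective lam) (xs - s *\<^sub>R A $ i) (shrink lam (xs - s *\<^sub>R A $ i)) y
      + (s - t) * (b $ i - A $ i \<bullet> y)"
    by (simp add: bregman_conj[OF lam] algebra_simps)
  moreover have "(s - t) * (b $ i - A $ i \<bullet> y) \<le> 2 * lam * norm1 (A $ i) * \<bar>b $ i - A $ i \<bullet> y\<bar>"
  proof -
    have "(s - t) * (b $ i - A $ i \<bullet> y) \<le> \<bar>s - t\<bar> * \<bar>b $ i - A $ i \<bullet> y\<bar>"
      by (metis abs_ge_self abs_mult)
    also have "\<dots> \<le> 2 * lam * norm1 (A $ i) * \<bar>b $ i - A $ i \<bullet> y\<bar>"
      using exact_step_close[OF lam a t] by (intro mult_right_mono) (auto simp: s_def)
    finally show ?thesis .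
  qed
  ultimately show ?thesis using bregman_step[OF lam a, of xs s y] by linarith
qed

lemma sigma_max_bound:
  fixes A :: "real ^ 'n ^ 'm"
  shows "norm (A *v x) \<le> sigma_max A * norm x"
proof (cases "x = 0")
  case False
  have "bdd_above {norm (A *v x) / norm x | x. x \<noteq> 0}"
    by (rule bdd_aboveI[of _ "onorm ((*v) A)"])
      (auto simp: pos_divide_le_eq intro!: onorm matrix_vector_mul_bounded_linear)
  then have "norm (A *v x) / norm x \<le> sigma_max A"
    unfolding sigma_max_def using False by (intro cSup_upper) auto
  with False show ?thesis by (simp add: field_simps)
qed simp

lemma sigma_max_nonneg: "sigma_max (A :: real ^ 'n ^ 'm) \<ge> 0"
proof -
  have "0 \<le> norm (A *v 1)" by simp
  also have "\<dots> \<le> sigma_max A * norm (1 :: real ^ 'n)" by (rule sigma_max_bound)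
  finally show ?thesis by (simp add: zero_le_mult_iff)
qed

lemma sigma_min_sub_nonneg:
  fixes A :: "real ^ 'n ^ 'm"
  assumes "J \<noteq> {}"
  shows "sigma_min_sub A I J \<ge> 0"
proof -
  obtain j where "j \<in> J" using assms by auto
  then have "\<exists>j\<in>J. (1 :: real ^ 'n) $ j \<noteq> 0" by auto
  then have "{L2_set (\<lambda>i. \<Sum>j\<in>J. A $ i $ j * x $ j) I / L2_set (\<lambda>j. x $ j) J
          | x :: real ^ 'n. \<exists>j\<in>J. x $ j \<noteq> 0} \<noteq> {}" by blast
  then show ?thesis unfolding sigma_min_sub_def
    by (rule cInf_greatest) (auto intro!: divide_nonneg_nonneg L2_set_nonneg)
qed

lemma sigma_tilde_min_bound:
  fixes A :: "real ^ 'n ^ 'm"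
  assumes I: "real (card I) = s"
  shows "(sigma_tilde_min A s)\<^sup>2 * (norm d)\<^sup>2 \<le> (\<Sum>i\<in>I. (A $ i \<bullet> d)\<^sup>2)"
proof (cases "d = 0")
  case False
  let ?T = "{sigma_min_sub A I J | I J. real (card I) = s \<and> J \<noteq> {}}"
  have fin: "finite ?T"
    by (rule finite_subset[of _ "(\<lambda>(I, J). sigma_min_sub A I J) ` UNIV"]) auto
  have mem: "sigma_min_sub A I UNIV \<in> ?T" using I by blast
  then have "sigma_tilde_min A s \<in> ?T" unfolding sigma_tilde_min_def using fin by (intro Min_in) auto
  then have nonneg: "sigma_tilde_min A s \<ge> 0" by (auto intro: sigma_min_sub_nonneg)
  have "sigma_tilde_min A s \<le> sigma_min_sub A I UNIV"
    unfolding sigma_tilde_min_def using fin mem by (rule Min_le)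
  also have "\<dots> \<le> L2_set (\<lambda>i. \<Sum>j\<in>UNIV. A $ i $ j * d $ j) I / L2_set (\<lambda>j. d $ j) UNIV"
    unfolding sigma_min_sub_def
  proof (rule cInf_lower)
    have "\<exists>j\<in>UNIV. d $ j \<noteq> 0" using False by (metis UNIV_I vec_eq_iff zero_index)
    then show "L2_set (\<lambda>i. \<Sum>j\<in>UNIV. A $ i $ j * d $ j) I / L2_set (\<lambda>j. d $ j) UNIV
      \<in> {L2_set (\<lambda>i. \<Sum>j\<in>UNIV. A $ i $ j * x $ j) I / L2_set (\<lambda>j. x $ j) UNIV
          | x :: real ^ 'n. \<exists>j\<in>UNIV. x $ j \<noteq> 0}" by blast
    show "bdd_below {L2_set (\<lambda>i. \<Sum>j\<in>UNIV. A $ i $ j * x $ j) I / L2_set (\<lambda>j. x $ j) UNIV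
          | x :: real ^ 'n. \<exists>j\<in>UNIV. x $ j \<noteq> 0}"
      by (rule bdd_belowI[of _ 0]) (auto intro!: divide_nonneg_nonneg L2_set_nonneg)
  qed
  also have "\<dots> = sqrt (\<Sum>i\<in>I. (A $ i \<bullet> d)\<^sup>2) / norm d"
    by (simp add: norm_vec_def L2_set_def inner_vec_def)
  finally have "sigma_tilde_min A s * norm d \<le> sqrt (\<Sum>i\<in>I. (A $ i \<bullet> d)\<^sup>2)"
    using False by (simp add: field_simps)
  then have "(sigma_tilde_min A s * norm d)\<^sup>2 \<le> (sqrt (\<Sum>i\<in>I. (A $ i \<bullet> d)\<^sup>2))\<^sup>2"
    using nonneg by (intro power_mono) auto
  then show ?thesis by (simp add: power_mult_distrib sum_nonneg)
qed (simp add: sum_nonneg)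

lemma sum_abs_rows_le:
  fixes A :: "real ^ 'n ^ 'm"
  shows "(\<Sum>i\<in>I. \<bar>A $ i \<bullet> d\<bar>) \<le> sqrt (card I) * (sigma_max A * norm d)"
proof -
  have "(\<Sum>i\<in>I. \<bar>A $ i \<bullet> d\<bar>)\<^sup>2 \<le> (\<Sum>i\<in>I. (A $ i \<bullet> d)\<^sup>2) * real (card I)"
    using sum_squared_le_sum_of_squares[of "\<lambda>i. \<bar>A $ i \<bullet> d\<bar>" I] by simp
  then have "(\<Sum>i\<in>I. \<bar>A $ i \<bullet> d\<bar>) \<le> sqrt ((\<Sum>i\<in>I. (A $ i \<bullet> d)\<^sup>2) * real (card I))"
    by (rule real_le_rsqrt)
  also have "\<dots> = sqrt (card I) * sqrt (\<Sum>i\<in>I. (A $ i \<bullet> d)\<^sup>2)"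
    by (simp add: real_sqrt_mult)
  also have "\<dots> \<le> sqrt (card I) * norm (A *v d)"
  proof (intro mult_left_mono)
    have "(\<Sum>i\<in>I. (A $ i \<bullet> d)\<^sup>2) \<le> (\<Sum>i\<in>UNIV. (A $ i \<bullet> d)\<^sup>2)"
      by (intro sum_mono2) auto
    also have "\<dots> = (norm (A *v d))\<^sup>2"
      by (simp add: norm_sq_sum matrix_vector_mul_component)
    finally show "sqrt (\<Sum>i\<in>I. (A $ i \<bullet> d)\<^sup>2) \<le> norm (A *v d)"
      by (intro real_le_lsqrt) (auto simp: sum_nonneg)
  qed simp
  also have "\<dots> \<le> sqrt (card I) * (sigma_max A * norm d)"
    by (intro mult_left_mono sigma_max_bound) simp
  finally show ?thesis .
qed

lemma card_ge_quantile:
  fixes y :: "'m::finite \<Rightarrow> real"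
  assumes l: "q * real CARD('m) = real l" "l < CARD('m)"
  shows "CARD('m) - l \<le> card {i. quantile q y \<le> y i}"
proof -
  define ys where "ys = sorted_list_of_multiset (image_mset y (mset_set UNIV))"
  have ys: "mset ys = image_mset y (mset_set UNIV)" "sorted ys" by (auto simp: ys_def)
  have len: "length ys = CARD('m)"
    by (metis ys(1) size_mset size_image_mset size_mset_set)
  have Q: "quantile q y = (ys ! (l - 1) + ys ! l) / 2"
    using l(1) by (simp add: quantile_def Let_def ys_def)
  have Ql: "quantile q y \<le> ys ! l"
    unfolding Q using sorted_nth_mono[OF ys(2), of "l - 1" l] l(2) len by simp
  have "CARD('m) - l = length (filter (\<lambda>v. quantile q y \<le> v) (drop l ys))"
  proof -
    have "quantile q y \<le> v" if v: "v \<in> set (drop l ys)" for v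
    proof -
      obtain j where "j < length ys - l" "v = ys ! (l + j)"
        using v l(2) len by (auto simp: in_set_conv_nth)
      then show ?thesis using sorted_nth_mono[OF ys(2), of l "l + j"]
        by (intro order.trans[OF Ql]) auto
    qed
    then show ?thesis by (simp add: filter_True len)
  qed
  also have "\<dots> \<le> length (filter (\<lambda>v. quantile q y \<le> v) (take l ys @ drop l ys))"
    unfolding filter_append by simp
  also have "\<dots> = size (filter_mset (\<lambda>v. quantile q y \<le> v) (mset ys))"
    by (simp flip: mset_filter)
  also have "\<dots> = card {i. quantile q y \<le> y i}"
    by (simp add: ys(1) filter_mset_image_mset)
  finally show ?thesis .
qed

lemma quantile_bound:
  fixes A :: "real ^ 'n ^ 'm" and e c :: "'m \<Rightarrow> real"
  assumes l: "q * real CARD('m) = real l" "l < CARD('m)"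
    and S: "real (card S) = \<beta> * real CARD('m)"
    and c: "\<And>i. i \<notin> S \<Longrightarrow> \<bar>c i\<bar> \<le> R" and R: "R \<ge> 0"
    and Q: "Q = quantile q (\<lambda>i. \<bar>A $ i \<bullet> d - c i\<bar>)" "Q \<ge> 0"
  shows "(1 - \<beta> - q) * real CARD('m) * Q
    \<le> sqrt ((1 - \<beta>) * real CARD('m)) * (sigma_max A * norm d) + (1 - \<beta>) * real CARD('m) * R"
proof -
  define T where "T = {i. Q \<le> \<bar>A $ i \<bullet> d - c i\<bar>}"
  have cS: "real (card (- S)) = (1 - \<beta>) * real CARD('m)"
    using S by (simp add: Compl_eq_Diff_UNIV card_Diff_subset of_nat_diff card_mono algebra_simps)
  have "CARD('m) - l \<le> card T"
    using card_ge_quantile[OF l] by (simp add: T_def Q(1))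
  moreover have "card T - card S \<le> card (T - S)"
    by (rule diff_card_le_card_Diff) simp
  ultimately have "real CARD('m) - real l - real (card S) \<le> real (card (T - S))"
    by linarith
  then have "(1 - \<beta> - q) * real CARD('m) \<le> real (card (T - S))"
    using l(1) S by (simp add: algebra_simps)
  then have "(1 - \<beta> - q) * real CARD('m) * Q \<le> real (card (T - S)) * Q"
    using Q(2) by (rule mult_right_mono)
  also have "\<dots> = (\<Sum>i\<in>T - S. Q)" by simp
  also have "\<dots> \<le> (\<Sum>i\<in>T - S. \<bar>A $ i \<bullet> d - c i\<bar>)"
    by (intro sum_mono) (auto simp: T_def)
  also have "\<dots> \<le> (\<Sum>i\<in>- S. \<bar>A $ i \<bullet> d - c i\<bar>)"
    by (intro sum_mono2) auto
  also have "\<dots> \<le> (\<Sum>i\<in>- S. \<bar>A $ i \<bullet> d\<bar> + R)"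
  proof (rule sum_mono)
    fix i assume "i \<in> - S"
    then show "\<bar>A $ i \<bullet> d - c i\<bar> \<le> \<bar>A $ i \<bullet> d\<bar> + R" using c[of i] by simp
  qed
  also have "\<dots> = (\<Sum>i\<in>- S. \<bar>A $ i \<bullet> d\<bar>) + real (card (- S)) * R"
    by (simp add: sum.distrib)
  also have "\<dots> \<le> sqrt (card (- S)) * (sigma_max A * norm d) + real (card (- S)) * R"
    by (intro add_right_mono sum_abs_rows_le)
  finally show ?thesis by (simp add: cS)
qed

text \<open>An uncorrupted row contributes \<open>- e\<^sup>2 / 2 + c\<^sup>2 / 2\<close>; a corrupted one passes the quantile
  test only with a step of modulus at most \<open>Q\<close>.\<close>

lemma sum_decrease_bound:
  fixes A :: "real ^ 'n ^ 'm" and c :: "'m \<Rightarrow> real"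
  assumes S: "real (card S) = \<beta> * real CARD('m)"
    and c: "\<And>i. i \<notin> S \<Longrightarrow> \<bar>c i\<bar> \<le> R"
    and Q: "\<And>i. i \<in> N \<Longrightarrow> \<bar>A $ i \<bullet> d - c i\<bar> \<le> Q" "Q \<ge> 0"
    and N: "card S \<le> card N" "real (card N - card S) = s"
  shows "(\<Sum>i\<in>N. - (A $ i \<bullet> d - c i) * (A $ i \<bullet> d) + (A $ i \<bullet> d - c i)\<^sup>2 / 2)
    \<le> - (sigma_tilde_min A s)\<^sup>2 * (norm d)\<^sup>2 / 2 + real (card N) * R\<^sup>2 / 2
      + Q * (sqrt (\<beta> * real CARD('m)) * (sigma_max A * norm d)) + \<beta> * real CARD('m) * Q\<^sup>2 / 2"
proof -
  define g where "g i = - (A $ i \<bullet> d - c i) * (A $ i \<bullet> d) + (A $ i \<bullet> d - c i)\<^sup>2 / 2" for i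
  have "card N - card S \<le> card (N - S)" by (rule diff_card_le_card_Diff) simp
  then obtain I where I: "I \<subseteq> N - S" "card I = card N - card S"
    by (meson obtain_subset_with_card_n)
  have "(\<Sum>i\<in>N - S. g i) \<le> (\<Sum>i\<in>N - S. R\<^sup>2 / 2 - (A $ i \<bullet> d)\<^sup>2 / 2)"
  proof (rule sum_mono)
    fix i assume "i \<in> N - S"
    then have "\<bar>c i\<bar>\<^sup>2 \<le> R\<^sup>2" using c by (intro power_mono) auto
    moreover have "g i = (c i)\<^sup>2 / 2 - (A $ i \<bullet> d)\<^sup>2 / 2"
      by (simp add: g_def power2_eq_square field_simps)
    ultimately show "g i \<le> R\<^sup>2 / 2 - (A $ i \<bullet> d)\<^sup>2 / 2" by simp
  qed
  also have "\<dots> = real (card (N - S)) * R\<^sup>2 / 2 - (\<Sum>i\<in>N - S. (A $ i \<bullet> d)\<^sup>2) / 2"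
    by (simp add: sum_subtractf sum_divide_distrib)
  also have "\<dots> \<le> real (card N) * R\<^sup>2 / 2 - (sigma_tilde_min A s)\<^sup>2 * (norm d)\<^sup>2 / 2"
  proof -
    have "real (card (N - S)) * R\<^sup>2 \<le> real (card N) * R\<^sup>2"
      by (intro mult_right_mono) (auto intro: card_mono)
    moreover have "(sigma_tilde_min A s)\<^sup>2 * (norm d)\<^sup>2 \<le> (\<Sum>i\<in>I. (A $ i \<bullet> d)\<^sup>2)"
      using I N by (intro sigma_tilde_min_bound) simp
    moreover have "(\<Sum>i\<in>I. (A $ i \<bullet> d)\<^sup>2) \<le> (\<Sum>i\<in>N - S. (A $ i \<bullet> d)\<^sup>2)"
      using I by (intro sum_mono2) auto
    ultimately show ?thesis by simp
  qed
  finally have good: "(\<Sum>i\<in>N - S. g i)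
    \<le> real (card N) * R\<^sup>2 / 2 - (sigma_tilde_min A s)\<^sup>2 * (norm d)\<^sup>2 / 2" .
  have "(\<Sum>i\<in>N \<inter> S. g i) \<le> (\<Sum>i\<in>N \<inter> S. Q * \<bar>A $ i \<bullet> d\<bar> + Q\<^sup>2 / 2)"
  proof (rule sum_mono)
    fix i assume i: "i \<in> N \<inter> S"
    have "- (A $ i \<bullet> d - c i) * (A $ i \<bullet> d) \<le> \<bar>A $ i \<bullet> d - c i\<bar> * \<bar>A $ i \<bullet> d\<bar>"
      by (metis abs_ge_self abs_minus_cancel abs_mult)
    also have "\<dots> \<le> Q * \<bar>A $ i \<bullet> d\<bar>" using Q i by (intro mult_right_mono) auto
    finally show "g i \<le> Q * \<bar>A $ i \<bullet> d\<bar> + Q\<^sup>2 / 2"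
      using power_mono[OF Q(1)[of i], of 2] i by (simp add: g_def)
  qed
  also have "\<dots> \<le> (\<Sum>i\<in>S. Q * \<bar>A $ i \<bullet> d\<bar> + Q\<^sup>2 / 2)"
    using Q(2) by (intro sum_mono2) auto
  also have "\<dots> = Q * (\<Sum>i\<in>S. \<bar>A $ i \<bullet> d\<bar>) + real (card S) * Q\<^sup>2 / 2"
    by (simp add: sum.distrib sum_distrib_left)
  also have "\<dots> \<le> Q * (sqrt (card S) * (sigma_max A * norm d)) + real (card S) * Q\<^sup>2 / 2"
    by (intro add_right_mono mult_left_mono sum_abs_rows_le Q)
  finally have "(\<Sum>i\<in>N \<inter> S. g i)
    \<le> Q * (sqrt (\<beta> * real CARD('m)) * (sigma_max A * norm d)) + \<beta> * real CARD('m) * Q\<^sup>2 / 2"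
    by (simp add: S)
  moreover have "(\<Sum>i\<in>N. g i) = (\<Sum>i\<in>N \<inter> S. g i) + (\<Sum>i\<in>N - S. g i)"
    by (rule sum.Int_Diff) simp
  ultimately show ?thesis using good by (simp add: g_def)
qed

text \<open>Here \<open>B\<close>, \<open>G\<close>, \<open>M\<close>, \<open>W\<close> are the square roots of \<open>\<beta>\<close>, \<open>1 - \<beta>\<close>, \<open>m\<close>, \<open>n\<close>. The mixed terms are
  split by \<open>\<delta> R \<le> \<delta>\<^sup>2 / W + W R\<^sup>2\<close>, which is where the dependence on \<open>n\<close> comes from.\<close>

lemma rate_algebra:
  fixes B G M W u q \<sigma> \<sigma>' \<alpha> D \<delta> R Q :: real
  assumes pos: "B \<ge> 0" "G \<ge> 0" "M > 0" "W > 0" "u > 0" "q > 0" "\<sigma> \<ge> 0" "\<delta> \<ge> 0" "R \<ge> 0" "Q \<ge> 0"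
    and D: "\<delta>\<^sup>2 \<le> 2 * D" "\<alpha> * D \<le> \<delta>\<^sup>2" and B: "B\<^sup>2 \<le> q" and \<alpha>: "\<alpha> \<ge> 0"
    and Q: "u * M\<^sup>2 * Q \<le> G * M * (\<sigma> * \<delta>) + G\<^sup>2 * M\<^sup>2 * R"
  shows "(- \<sigma>'\<^sup>2 * \<delta>\<^sup>2 / 2 + q * M\<^sup>2 * R\<^sup>2 / 2 + Q * (B * M * (\<sigma> * \<delta>)) + B\<^sup>2 * M\<^sup>2 * Q\<^sup>2 / 2) / (q * M\<^sup>2)
    \<le> - (\<alpha> * (q - B\<^sup>2) / (2 * q\<^sup>2) * (\<sigma>'\<^sup>2 / M\<^sup>2)
       - 2 * (B * G) / (q * u) * (\<sigma>\<^sup>2 / M\<^sup>2 + G * \<sigma> / (M * W))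
       - B\<^sup>2 * G\<^sup>2 / (q * u\<^sup>2) * (\<sigma>\<^sup>2 / M\<^sup>2 + 2 * G * \<sigma> / (M * W))) * D
     + (B * G\<^sup>2 / (q * u) * (1 + B * G / u) * (W / M) * \<sigma>
       + 1 / 2 * (B\<^sup>2 * G\<^sup>2 * G\<^sup>2 / (q * u\<^sup>2)) + 1 / 2) * R\<^sup>2"
proof -
  define P K where "P = G * \<sigma> / (M * u)" and "K = G\<^sup>2 / u"
  define X where "X = 2 * D / W + W * R\<^sup>2"
  have PK: "P \<ge> 0" "K \<ge> 0" using pos by (auto simp: P_def K_def)
  have D0: "D \<ge> 0" using D zero_le_power2[of \<delta>] by linarith
  have QPK: "Q \<le> P * \<delta> + K * R"
  proof -
    have "M * (u * M * Q) \<le> M * (G * (\<sigma> * \<delta>) + G\<^sup>2 * M * R)"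
      using Q by (simp add: power2_eq_square algebra_simps)
    then have "u * M * Q \<le> G * (\<sigma> * \<delta>) + G\<^sup>2 * M * R" using pos by simp
    then show ?thesis using pos by (simp add: P_def K_def field_simps)
  qed
  have X: "\<delta> * R \<le> X"
  proof -
    have "0 \<le> (\<delta> - W * R)\<^sup>2" by simp
    then have "2 * (\<delta> * R) * W \<le> \<delta>\<^sup>2 + W\<^sup>2 * R\<^sup>2" by (simp add: power2_eq_square algebra_simps)
    moreover have "0 \<le> W\<^sup>2 * R\<^sup>2" by simp
    ultimately have "(\<delta> * R) * W \<le> 2 * D + W\<^sup>2 * R\<^sup>2" using D(1) D0 by linarith
    then have "\<delta> * R \<le> (2 * D + W\<^sup>2 * R\<^sup>2) / W" using pos by (simp add: pos_le_divide_eq)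
    also have "\<dots> = X" using pos by (simp add: X_def add_divide_distrib power2_eq_square)
    finally show ?thesis .
  qed
  have 1: "\<alpha> * (q - B\<^sup>2) / (2 * q\<^sup>2) * (\<sigma>'\<^sup>2 / M\<^sup>2) * D \<le> \<sigma>'\<^sup>2 * \<delta>\<^sup>2 / (2 * q * M\<^sup>2)"
  proof -
    have "(q - B\<^sup>2) * (\<alpha> * D) \<le> q * \<delta>\<^sup>2"
      using pos B D \<alpha> D0 by (intro mult_mono) auto
    then have "(q - B\<^sup>2) * (\<alpha> * D) * (\<sigma>'\<^sup>2 / (2 * q\<^sup>2 * M\<^sup>2)) \<le> q * \<delta>\<^sup>2 * (\<sigma>'\<^sup>2 / (2 * q\<^sup>2 * M\<^sup>2))"
      by (rule mult_right_mono) simp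
    also have "q * \<delta>\<^sup>2 * (\<sigma>'\<^sup>2 / (2 * q\<^sup>2 * M\<^sup>2)) = \<sigma>'\<^sup>2 * \<delta>\<^sup>2 / (2 * q * M\<^sup>2)"
      using pos by (simp add: power2_eq_square mult.assoc mult.left_commute)
    finally show ?thesis by (simp add: mult_ac)
  qed
  have 3: "B * \<sigma> / (q * M) * (Q * \<delta>) \<le> B * \<sigma> / (q * M) * (P * (2 * D) + K * X)"
  proof (intro mult_left_mono)
    have "Q * \<delta> \<le> (P * \<delta> + K * R) * \<delta>" using QPK pos(8) by (rule mult_right_mono)
    also have "\<dots> = P * \<delta>\<^sup>2 + K * (\<delta> * R)" by (simp add: power2_eq_square algebra_simps)
    also have "\<dots> \<le> P * (2 * D) + K * X" using PK D(1) X by (simp add: add_mono mult_left_mono)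
    finally show "Q * \<delta> \<le> P * (2 * D) + K * X" .
  qed (use pos in auto)
  have 4: "B\<^sup>2 / (2 * q) * Q\<^sup>2 \<le> B\<^sup>2 / (2 * q) * (P\<^sup>2 * (2 * D) + 2 * P * K * X + K\<^sup>2 * R\<^sup>2)"
  proof (intro mult_left_mono)
    have "Q\<^sup>2 \<le> (P * \<delta> + K * R)\<^sup>2" using QPK pos by (intro power_mono)
    also have "\<dots> = P\<^sup>2 * \<delta>\<^sup>2 + 2 * P * K * (\<delta> * R) + K\<^sup>2 * R\<^sup>2"
      by (simp add: power2_eq_square algebra_simps)
    also have "\<dots> \<le> P\<^sup>2 * (2 * D) + 2 * P * K * X + K\<^sup>2 * R\<^sup>2"
      using PK D(1) X by (simp add: add_mono mult_left_mono)
    finally show "Q\<^sup>2 \<le> P\<^sup>2 * (2 * D) + 2 * P * K * X + K\<^sup>2 * R\<^sup>2" .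
  qed (use pos in auto)
  have "(- \<sigma>'\<^sup>2 * \<delta>\<^sup>2 / 2 + q * M\<^sup>2 * R\<^sup>2 / 2 + Q * (B * M * (\<sigma> * \<delta>)) + B\<^sup>2 * M\<^sup>2 * Q\<^sup>2 / 2) / (q * M\<^sup>2)
    = - (\<sigma>'\<^sup>2 * \<delta>\<^sup>2 / (2 * q * M\<^sup>2)) + R\<^sup>2 / 2 + B * \<sigma> / (q * M) * (Q * \<delta>) + B\<^sup>2 / (2 * q) * Q\<^sup>2"
  proof -
    have "- \<sigma>'\<^sup>2 * \<delta>\<^sup>2 / 2 / (q * M\<^sup>2) = - (\<sigma>'\<^sup>2 * \<delta>\<^sup>2 / (2 * q * M\<^sup>2))"
      "q * M\<^sup>2 * R\<^sup>2 / 2 / (q * M\<^sup>2) = R\<^sup>2 / 2"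
      "Q * (B * M * (\<sigma> * \<delta>)) / (q * M\<^sup>2) = B * \<sigma> / (q * M) * (Q * \<delta>)"
      "B\<^sup>2 * M\<^sup>2 * Q\<^sup>2 / 2 / (q * M\<^sup>2) = B\<^sup>2 / (2 * q) * Q\<^sup>2"
      using pos by (simp_all add: power2_eq_square)
    then show ?thesis by (simp only: add_divide_distrib)
  qed
  also have "\<dots> \<le> - (\<alpha> * (q - B\<^sup>2) / (2 * q\<^sup>2) * (\<sigma>'\<^sup>2 / M\<^sup>2) * D) + R\<^sup>2 / 2
    + B * \<sigma> / (q * M) * (P * (2 * D) + K * X)
    + B\<^sup>2 / (2 * q) * (P\<^sup>2 * (2 * D) + 2 * P * K * X + K\<^sup>2 * R\<^sup>2)"
    using 1 3 4 by linarith
  also have "B * \<sigma> / (q * M) * (P * (2 * D) + K * X)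
    = 2 * (B * G) / (q * u) * (\<sigma>\<^sup>2 / M\<^sup>2 + G * \<sigma> / (M * W)) * D
      + B * G\<^sup>2 / (q * u) * (W / M) * \<sigma> * R\<^sup>2"
    by (simp add: P_def K_def X_def divide_inverse power2_eq_square algebra_simps)
  also have "B\<^sup>2 / (2 * q) * (P\<^sup>2 * (2 * D) + 2 * P * K * X + K\<^sup>2 * R\<^sup>2)
    = B\<^sup>2 * G\<^sup>2 / (q * u\<^sup>2) * (\<sigma>\<^sup>2 / M\<^sup>2 + 2 * G * \<sigma> / (M * W)) * D
      + B * G\<^sup>2 / (q * u) * (B * G / u) * (W / M) * \<sigma> * R\<^sup>2
      + 1 / 2 * (B\<^sup>2 * G\<^sup>2 * G\<^sup>2 / (q * u\<^sup>2)) * R\<^sup>2"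
  proof -
    have "B\<^sup>2 / (2 * q) * (P\<^sup>2 * (2 * D) + 2 * P * K * X + K\<^sup>2 * R\<^sup>2)
      = B\<^sup>2 / q * P\<^sup>2 * D + B\<^sup>2 / q * (P * K) * (2 * D / W) + B\<^sup>2 / q * (P * K) * (W * R\<^sup>2)
        + B\<^sup>2 / q * K\<^sup>2 / 2 * R\<^sup>2"
      by (simp add: X_def ring_distribs add_divide_distrib mult_ac)
    also have "B\<^sup>2 / q * P\<^sup>2 = B\<^sup>2 * G\<^sup>2 / (q * u\<^sup>2) * (\<sigma>\<^sup>2 / M\<^sup>2)"
      by (simp add: P_def power_mult_distrib power_divide mult_ac)
    also have "B\<^sup>2 / q * (P * K) * (2 * D / W) = B\<^sup>2 * G\<^sup>2 / (q * u\<^sup>2) * (2 * G * \<sigma> / (M * W)) * D"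
      by (simp add: P_def K_def power2_eq_square mult_ac)
    also have "B\<^sup>2 / q * (P * K) * (W * R\<^sup>2)
      = B * G\<^sup>2 / (q * u) * (B * G / u) * (W / M) * \<sigma> * R\<^sup>2"
      by (simp add: P_def K_def power2_eq_square mult_ac)
    also have "B\<^sup>2 / q * K\<^sup>2 / 2 = 1 / 2 * (B\<^sup>2 * G\<^sup>2 * G\<^sup>2 / (q * u\<^sup>2))"
      by (simp add: K_def power2_eq_square mult_ac)
    finally show ?thesis by (simp only: distrib_left distrib_right)
  qed
  also have "- (T1 * D) + R\<^sup>2 / 2 + (T2 * D + U * w * s * R\<^sup>2) + (T3 * D + U * V * w * s * R\<^sup>2 + Y * R\<^sup>2)
    = - (T1 - T2 - T3) * D + (U * (1 + V) * w * s + Y + 1 / 2) * R\<^sup>2"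
    for T1 T2 T3 U V Y w s
    by (simp add: algebra_simps)
  finally show ?thesis .
qed

lemma finite_set_index_law:
  fixes N :: "'m::finite list \<Rightarrow> 'm set"
  shows "(\<And>h. N h \<noteq> {}) \<Longrightarrow> finite (set_pmf (index_law N k))"
  by (induction k) auto

lemma expected_bregman_step:
  fixes N :: "'m::finite list \<Rightarrow> 'm set"
  assumes N: "\<And>h. N h \<noteq> {}"
    and step: "\<And>h. (\<Sum>i\<in>N h. bregman (objective lam) (xs (h @ [i])) (shrink lam (xs (h @ [i]))) xhat)
        / card (N h) \<le> \<rho> * bregman (objective lam) (xs h) (shrink lam (xs h)) xhat + \<kappa>"
  shows "expected_bregman lam xhat N xs (Suc k) \<le> \<rho> * expected_bregman lam xhat N xs k + \<kappa>"
proof -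
  let ?D = "\<lambda>h. bregman (objective lam) (xs h) (shrink lam (xs h)) xhat"
  let ?p = "index_law N k"
  have fin: "finite (set_pmf ?p)" by (intro finite_set_index_law N)
  have int: "integrable (measure_pmf ?p) f" for f :: "'m list \<Rightarrow> real"
    using fin by (rule integrable_measure_pmf_finite)
  have "expected_bregman lam xhat N xs (Suc k) =
    (\<Sum>h\<in>set_pmf ?p. pmf ?p h *\<^sub>R
       measure_pmf.expectation (map_pmf (\<lambda>i. h @ [i]) (pmf_of_set (N h))) ?D)"
    unfolding expected_bregman_def index_law.simps
    using N fin by (intro pmf_expectation_bind) auto
  also have "\<dots> = (\<Sum>h\<in>set_pmf ?p. pmf ?p h * ((\<Sum>i\<in>N h. ?D (h @ [i])) / card (N h)))"
    using N by (simp add: integral_pmf_of_set)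
  also have "\<dots> \<le> (\<Sum>h\<in>set_pmf ?p. pmf ?p h * (\<rho> * ?D h + \<kappa>))"
    by (intro sum_mono mult_left_mono step) simp
  also have "\<dots> = measure_pmf.expectation ?p (\<lambda>h. \<rho> * ?D h + \<kappa>)"
    using fin by (subst integral_measure_pmf_real[of "set_pmf ?p"]) (auto simp: mult.commute)
  also have "\<dots> = \<rho> * expected_bregman lam xhat N xs k + \<kappa>"
    unfolding expected_bregman_def using int by (subst Bochner_Integration.integral_add) auto
  finally show ?thesis .
qed

lemma sum_norm1_le:
  fixes A :: "real ^ 'n ^ 'm"
  shows "(\<Sum>i\<in>I. norm1 (A $ i) * \<bar>v $ i\<bar>) \<le> norm v * norm12 A"
proof -
  have "(\<Sum>i\<in>I. norm1 (A $ i) * \<bar>v $ i\<bar>) \<le> (\<Sum>i\<in>UNIV. \<bar>norm1 (A $ i)\<bar> * \<bar>v $ i\<bar>)"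
    by (rule order.trans[OF sum_mono sum_mono2]) (auto simp: mult_right_mono)
  also have "\<dots> \<le> L2_set (\<lambda>i. norm1 (A $ i)) UNIV * L2_set (\<lambda>i. v $ i) UNIV"
    by (rule L2_set_mult_ineq)
  finally show ?thesis by (simp add: norm12_def norm_vec_def L2_set_def mult.commute)
qed

theorem theorem1:
  fixes A :: "real ^ 'n ^ 'm" and xhat :: "real ^ 'n" and b btilde bc r :: "real ^ 'm"
    and lam \<beta> q m n \<alpha> \<sigma> \<sigma>' C1 C2 :: real
  assumes m: "m = real CARD('m)" and n: "n = real CARD('n)"
    and full_rank: "rank A = min CARD('m) CARD('n)"
    and unit_rows: "\<And>i. norm (A $ i) = 1"
    and xhat: "xhat \<noteq> 0"
    and btilde: "btilde = A *v xhat"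
    and b: "b = btilde + bc + r"
    and bc: "real (card {i. bc $ i \<noteq> 0}) = \<beta> * m"
    and qm: "q * m \<in> \<int>"
    and lam: "lam > 0"
    and q: "\<beta> < q" "q < 1 - \<beta>"
    and \<alpha>: "\<alpha> = abs_min xhat / (abs_min xhat + 2 * lam)"
    and \<sigma>: "\<sigma> = sigma_max A"
    and \<sigma>': "\<sigma>' = sigma_tilde_min A ((q - \<beta>) * m)"
    and cond:
      "2 * sqrt (\<beta> * (1 - \<beta>)) / (1 - \<beta> - q) * (\<sigma> + sqrt ((1 - \<beta>) * m / n))
       + \<beta> * (1 - \<beta>) / (1 - \<beta> - q)\<^sup>2 * (\<sigma> + 2 * sqrt ((1 - \<beta>) * m / n))
       < \<alpha> * (q - \<beta>) / (2 * q) * (\<sigma>'\<^sup>2 / \<sigma>)"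
    and C1:
      "C1 = \<alpha> * (q - \<beta>) / (2 * q\<^sup>2) * (\<sigma>'\<^sup>2 / m)
       - 2 * sqrt (\<beta> * (1 - \<beta>)) / (q * (1 - \<beta> - q))
           * (\<sigma>\<^sup>2 / m + sqrt (1 - \<beta>) * \<sigma> / sqrt (m * n))
       - \<beta> * (1 - \<beta>) / (q * (1 - \<beta> - q)\<^sup>2)
           * (\<sigma>\<^sup>2 / m + 2 * sqrt (1 - \<beta>) * \<sigma> / sqrt (m * n))"
    and C2:
      "C2 = sqrt \<beta> * (1 - \<beta>) / (q * (1 - \<beta> - q))
           * (1 + sqrt (\<beta> * (1 - \<beta>)) / (1 - \<beta> - q)) * sqrt (n / m) * \<sigma>
       + 1 / 2 * (\<beta> * (1 - \<beta>)\<^sup>2 / (q * (1 - \<beta> - q)\<^sup>2)) + 1 / 2"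
  shows
    "(\<forall>N t xs. quantile_rask inexact_step lam q A b N t xs \<longrightarrow>
       (\<forall>k. expected_bregman lam xhat N xs (Suc k)
            \<le> (1 - C1) * expected_bregman lam xhat N xs k + C2 * (infnorm r)\<^sup>2))
     \<and>
     (\<forall>N t xs. quantile_rask exact_step lam q A b N t xs \<longrightarrow>
       (\<forall>k. expected_bregman lam xhat N xs (Suc k)
            \<le> (1 - C1) * expected_bregman lam xhat N xs k + C2 * (infnorm r)\<^sup>2
              + 2 / sqrt (q * m) * infnorm r * norm12 A
              + 2 * lam / (q * m) * norm (b - btilde) * norm12 A))"
proof -
  define R where "R = infnorm r"
  define S where "S = {i. bc $ i \<noteq> 0}"
  define D where "D xs = bregman (objective lam) xs (shrink lam xs) xhat" for xs
  have m0: "m > 0" and n0: "n > 0" by (simp_all add: m n)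
  have "\<beta> * m \<ge> 0" using bc by (metis of_nat_0_le_iff)
  then have \<beta>0: "\<beta> \<ge> 0" using m0 by (simp add: zero_le_mult_iff)
  then have q0: "q > 0" using q by simp
  have R0: "R \<ge> 0" by (simp add: R_def infnorm_pos_le)
  have c: "\<bar>b $ i - btilde $ i\<bar> \<le> R" if "i \<notin> S" for i
    using that component_le_infnorm_cart[of r i] by (simp add: b S_def R_def)
  have cS: "real (card S) = \<beta> * real CARD('m)" using bc by (simp add: S_def m)
  have e: "A $ i \<bullet> (x - xhat) - (b $ i - btilde $ i) = A $ i \<bullet> x - b $ i" for x i
    by (simp add: btilde matrix_vector_mul_component inner_diff_right)
  have mean: "(\<Sum>i\<in>N h. D (xs (h @ [i]))) / card (N h)
      \<le> (1 - C1) * D (xs h) + (C2 * R\<^sup>2 + (\<Sum>i\<in>N h. \<epsilon> i) / (q * m))"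
    if run: "quantile_rask rule lam q A b N t xs"
      and rule: "\<And>xs i t. rule lam A b xs i t \<Longrightarrow>
        D (xs - t *\<^sub>R A $ i) \<le> D xs - (A $ i \<bullet> shrink lam xs - b $ i) * (A $ i \<bullet> (shrink lam xs - xhat))
          + (A $ i \<bullet> shrink lam xs - b $ i)\<^sup>2 / 2 + \<epsilon> i"
    for rule N t xs h and \<epsilon> :: "'m \<Rightarrow> real"
  proof -
    define x where "x = shrink lam (xs h)"
    define d where "d = x - xhat"
    define Q where "Q = quantile q (residual A b x)"
    have N: "N h \<subseteq> {i. residual A b x i \<le> Q}" "real (card (N h)) = q * m"
      and next_iterate: "\<And>i. i \<in> N h \<Longrightarrow> rule lam A b (xs h) i (t h i) \<and> xs (h @ [i]) = xs h - t h i *\<^sub>R A $ i"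
      using run unfolding quantile_rask_def Let_def m Q_def x_def by blast+
    have "q * m < 1 * m" using q \<beta>0 m0 by (intro mult_strict_right_mono) auto
    then have "real (card (N h)) < real CARD('m)" using N(2) m by linarith
    then have cardN: "card (N h) < CARD('m)" by simp
    have "card (N h) \<noteq> 0" using N(2) q0 m0 by auto
    then obtain i0 where "i0 \<in> N h" by fastforce
    then have "\<bar>A $ i0 \<bullet> x - b $ i0\<bar> \<le> Q" using N(1) by (auto simp: residual_def)
    then have Q0: "Q \<ge> 0" using abs_ge_zero order.trans by blast
    have res: "residual A b x = (\<lambda>i. \<bar>A $ i \<bullet> d - (b $ i - btilde $ i)\<bar>)"
      by (simp add: residual_def d_def e fun_eq_iff)
    have "\<beta> * m < q * m" using q m0 by simp
    then have "real (card S) < real (card (N h))" using N(2) cS by (simp only: m)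
    then have SN: "card S < card (N h)" by simp
    then have SN': "real (card (N h) - card S) = (q - \<beta>) * m"
      using N(2) cS by (simp add: of_nat_diff m algebra_simps)
    have D1: "(norm d)\<^sup>2 \<le> 2 * D (xs h)"
      using norm_sq_le_bregman[of lam "xs h" xhat] lam by (simp add: D_def d_def x_def)
    have D2: "\<alpha> * D (xs h) \<le> (norm d)\<^sup>2"
      using bregman_le_norm_sq[of lam xhat "xs h"] lam xhat by (simp add: D_def d_def x_def \<alpha>)
    have \<alpha>0: "\<alpha> \<ge> 0" using abs_min_props(1)[OF xhat] lam by (simp add: \<alpha>)
    have Qle: "(1 - \<beta> - q) * m * Q \<le> sqrt ((1 - \<beta>) * m) * (\<sigma> * norm d) + (1 - \<beta>) * m * R"
      using quantile_bound[of q "card (N h)" S \<beta> "\<lambda>i. b $ i - btilde $ i" R Q A d]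
        N(2) cardN cS c R0 Q0 by (simp add: m \<sigma> Q_def res)
    have "(\<Sum>i\<in>N h. D (xs (h @ [i])))
      \<le> (\<Sum>i\<in>N h. D (xs h) + (- (A $ i \<bullet> d - (b $ i - btilde $ i)) * (A $ i \<bullet> d)
          + (A $ i \<bullet> d - (b $ i - btilde $ i))\<^sup>2 / 2) + \<epsilon> i)"
    proof (rule sum_mono)
      fix i assume "i \<in> N h"
      then show "D (xs (h @ [i])) \<le> D (xs h) + (- (A $ i \<bullet> d - (b $ i - btilde $ i)) * (A $ i \<bullet> d)
          + (A $ i \<bullet> d - (b $ i - btilde $ i))\<^sup>2 / 2) + \<epsilon> i"
        using next_iterate[of i] rule[of "xs h" i "t h i"]
        unfolding d_def e x_def mult_minus_left by simp
    qed
    also have "\<dots> = q * m * D (xs h) + (\<Sum>i\<in>N h. - (A $ i \<bullet> d - (b $ i - btilde $ i)) * (A $ i \<bullet> d)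
          + (A $ i \<bullet> d - (b $ i - btilde $ i))\<^sup>2 / 2) + (\<Sum>i\<in>N h. \<epsilon> i)"
      by (simp only: sum.distrib sum_constant N(2))
    also have "\<dots> \<le> q * m * D (xs h) + (- \<sigma>'\<^sup>2 * (norm d)\<^sup>2 / 2 + q * m * R\<^sup>2 / 2
        + Q * (sqrt (\<beta> * m) * (\<sigma> * norm d)) + \<beta> * m * Q\<^sup>2 / 2) + (\<Sum>i\<in>N h. \<epsilon> i)"
      using sum_decrease_bound[of S \<beta> "\<lambda>i. b $ i - btilde $ i" R "N h" A d Q, OF cS c _ Q0 _ SN']
        N SN by (simp add: res N(2) \<sigma> \<sigma>' m subset_iff)
    finally have "(\<Sum>i\<in>N h. D (xs (h @ [i]))) / (q * m)
      \<le> (q * m * D (xs h) + (- \<sigma>'\<^sup>2 * (norm d)\<^sup>2 / 2 + q * m * R\<^sup>2 / 2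
        + Q * (sqrt (\<beta> * m) * (\<sigma> * norm d)) + \<beta> * m * Q\<^sup>2 / 2) + (\<Sum>i\<in>N h. \<epsilon> i)) / (q * m)"
      using q0 m0 by (intro divide_right_mono) auto
    also have "\<dots> = D (xs h) + (- \<sigma>'\<^sup>2 * (norm d)\<^sup>2 / 2 + q * m * R\<^sup>2 / 2
        + Q * (sqrt (\<beta> * m) * (\<sigma> * norm d)) + \<beta> * m * Q\<^sup>2 / 2) / (q * m) + (\<Sum>i\<in>N h. \<epsilon> i) / (q * m)"
      using q0 m0 by (simp add: add_divide_distrib)
    also have "(- \<sigma>'\<^sup>2 * (norm d)\<^sup>2 / 2 + q * m * R\<^sup>2 / 2
        + Q * (sqrt (\<beta> * m) * (\<sigma> * norm d)) + \<beta> * m * Q\<^sup>2 / 2) / (q * m) \<le> - C1 * D (xs h) + C2 * R\<^sup>2"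
    proof -
      have sq: "(sqrt \<beta>)\<^sup>2 = \<beta>" "(sqrt (1 - \<beta>))\<^sup>2 = 1 - \<beta>" "(sqrt m)\<^sup>2 = m"
        using \<beta>0 q0 q m0 by auto
      have "sqrt \<beta> \<ge> 0" "sqrt (1 - \<beta>) \<ge> 0" "sqrt m > 0" "sqrt n > 0" "1 - \<beta> - q > 0" "\<sigma> \<ge> 0"
        using \<beta>0 q0 q m0 n0 sigma_max_nonneg by (auto simp: \<sigma>)
      from rate_algebra[OF this(1-5) q0 this(6) norm_ge_zero R0 Q0 D1 D2 _ \<alpha>0, of \<sigma>']
      show ?thesis
        using Qle q unfolding sq C1 C2
        by (simp add: real_sqrt_mult real_sqrt_divide power2_eq_square mult.assoc)
    qed
    finally show ?thesis by (simp add: N(2) algebra_simps)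
  qed
  have nonempty: "N h \<noteq> {}" if "quantile_rask rule lam q A b N t xs" for rule N t xs h
  proof
    assume "N h = {}"
    moreover have "real (card (N h)) = q * m"
      using that unfolding quantile_rask_def Let_def m by blast
    ultimately show False using q0 m0 by simp
  qed
  have inexact: "expected_bregman lam xhat N xs (Suc k)
      \<le> (1 - C1) * expected_bregman lam xhat N xs k + C2 * (infnorm r)\<^sup>2"
    if run: "quantile_rask inexact_step lam q A b N t xs" for N t xs k
  proof (rule expected_bregman_step)
    show "N h \<noteq> {}" for h using nonempty[OF run] .
    have "D (xs - t *\<^sub>R A $ i) \<le> D xs - (A $ i \<bullet> shrink lam xs - b $ i) * (A $ i \<bullet> (shrink lam xs - xhat))
          + (A $ i \<bullet> shrink lam xs - b $ i)\<^sup>2 / 2 + 0"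
      if "inexact_step lam A b xs i t" for xs i t
      using bregman_step[of lam "A $ i" xs t xhat] lam unit_rows that by (simp add: D_def inexact_step_def)
    from mean[OF run this]
    show "(\<Sum>i\<in>N h. bregman (objective lam) (xs (h @ [i])) (shrink lam (xs (h @ [i]))) xhat) / card (N h)
      \<le> (1 - C1) * bregman (objective lam) (xs h) (shrink lam (xs h)) xhat + C2 * (infnorm r)\<^sup>2" for h
      by (simp add: D_def R_def)
  qed
  have exact: "expected_bregman lam xhat N xs (Suc k)
      \<le> (1 - C1) * expected_bregman lam xhat N xs k
        + (C2 * (infnorm r)\<^sup>2 + 2 * lam / (q * m) * norm (b - btilde) * norm12 A)"
    if run: "quantile_rask exact_step lam q A b N t xs" for N t xs k
  proof (rule expected_bregman_step)
    show "N h \<noteq> {}" for h using nonempty[OF run] .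
    fix h
    define \<epsilon> where "\<epsilon> i = 2 * lam * norm1 (A $ i) * \<bar>b $ i - btilde $ i\<bar>" for i
    have "D (xs - t *\<^sub>R A $ i) \<le> D xs - (A $ i \<bullet> shrink lam xs - b $ i) * (A $ i \<bullet> (shrink lam xs - xhat))
          + (A $ i \<bullet> shrink lam xs - b $ i)\<^sup>2 / 2 + \<epsilon> i"
      if "exact_step lam A b xs i t" for xs i t
      using bregman_exact_step[OF _ unit_rows that, of xhat] lam
      by (simp add: D_def \<epsilon>_def btilde matrix_vector_mul_component)
    from mean[OF run this, of h]
    have "(\<Sum>i\<in>N h. D (xs (h @ [i]))) / card (N h)
      \<le> (1 - C1) * D (xs h) + (C2 * R\<^sup>2 + (\<Sum>i\<in>N h. \<epsilon> i) / (q * m))" .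
    also have "(\<Sum>i\<in>N h. \<epsilon> i) / (q * m) \<le> 2 * lam / (q * m) * norm (b - btilde) * norm12 A"
    proof -
      have "(\<Sum>i\<in>N h. \<epsilon> i) = 2 * lam * (\<Sum>i\<in>N h. norm1 (A $ i) * \<bar>(b - btilde) $ i\<bar>)"
        by (simp add: \<epsilon>_def sum_distrib_left mult.assoc)
      also have "\<dots> \<le> 2 * lam * (norm (b - btilde) * norm12 A)"
        using lam by (intro mult_left_mono sum_norm1_le) auto
      finally show ?thesis using q0 m0 by (simp add: divide_right_mono mult.assoc)
    qed
    finally show "(\<Sum>i\<in>N h. bregman (objective lam) (xs (h @ [i])) (shrink lam (xs (h @ [i]))) xhat) / card (N h)
      \<le> (1 - C1) * bregman (objective lam) (xs h) (shrink lam (xs h)) xhat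
        + (C2 * (infnorm r)\<^sup>2 + 2 * lam / (q * m) * norm (b - btilde) * norm12 A)"
      by (simp add: D_def R_def)
  qed
  have "2 / sqrt (q * m) * infnorm r * norm12 A \<ge> 0"
    using q0 m0 by (simp add: norm12_def infnorm_pos_le sum_nonneg)
  with inexact exact show ?thesis by (smt (verit))
qed

end
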